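(* Let $T$ be a context-free raw type theory. If $\vdash_T\mathcal B[e]$ is derivable (for an abstracted boundary $\mathcal B$ and a head $e$) and $\mathcal B[e]$ has well-typed annotations, then $\vdash_T\mathcal B$ is derivable.
   Context: Well-typed annotations: an expression, judgement or boundary $X$ has well-typed annotations when $\vdash_T\mathcal B'$ for every $M^{\mathcal B'}\in\mathrm{asm}(X)$ and $\vdash_T A\ \mathsf{type}$ for every $a^A\in\mathrm{asm}(X)$. Context-free raw syntax. A signature $\Sigma$ assigns to each symbol $S$ an arity $(c,[(c_1,n_1),\dots,(c_k,n_k)])$, $c\in\{\mathrm{Ty},\mathrm{Tm}\}$, $c_i\in\{\mathrm{Ty},\mathrm{Tm},\mathrm{EqTy},\mathrm{EqTm}\}$ (the $i$-th argument has class $c_i$ and binds $n_i$ variables). Free variables are annotated with types, $a^A$ ($A$ a type expression with no unbound bound variables); $a^A$ and $b^B$ are equal iff $a=b$ and $A=B$ syntactically. Metavariables are annotated with closed boundaries, $M^{\mathcal B}$, equal iff names and boundaries coincide; $M^{\mathcal B}$ has arity $(c,m)$ where $\mathcal B=\{x_1{:}A_1\}\cdots\{x_m{:}A_m\}\beta$ and $c$ is the class of $\beta$ (Ty, Tm, EqTy, EqTm). Type expressions: $S(e_1,\dots,e_k)$, $M^{\mathcal B}(t_1,\dots,t_n)$. Term expressions: $a^A$, bound variables $x$, $S(e_1,\dots,e_k)$, $M^{\mathcal B}(t_1,\dots,t_n)$, and conversion terms $\mathrm{cv}(t,\alpha)$. Assumption sets $\alpha$ are finite sets of annotated free variables, bound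 variables and annotated metavariables; they are the arguments of class EqTy/EqTm. Arguments: types, terms, assumption sets, abstractions $\{x\}e$. Judgement theses: $A\ \mathsf{type}$, $t:A$, $A\equiv B\ \mathsf{by}\ \alpha$, $s\equiv t:A\ \mathsf{by}\ \alpha$; abstracted judgements $\mathcal J::=\text{thesis}\mid\{x{:}A\}\mathcal J$. Boundary theses $\Box\ \mathsf{type}$, $\Box:A$, $A\equiv B\ \mathsf{by}\ \Box$, $s\equiv t:A\ \mathsf{by}\ \Box$; abstracted boundaries $\mathcal B::=\text{thesis}\mid\{x{:}A\}\mathcal B$. Occurrences: $\mathrm{fv}(e)$ is the set of all annotated free variables occurring in $e$ (including in assumption sets and, recursively, in type annotations of occurring variables); $\mathrm{bv}(e)$ the bound variables occurring free in $e$ (including in assumption sets); $\mathrm{mv}(e)$ the annotated metavariables occurring in $e$ (including inside annotations, boundaries of metavariables and assumption sets); $\mathrm{asm}(e)=\mathrm{fv}(e)\cup\mathrm{bv}(e)\cup\mathrm{mv}(e)$, and $\mathrm{asm}(e_1,\dots,e_n)=\bigcup_i\mathrm{asm}(e_i)$, extended componentwise to judgements and boundaries. Substitution $e[s/x]$ replaces the bound variable $x$ by $s$ (capture-avoiding), and in an assumption set containing $x$ replaces $x$ by the elements of $\mathrm{asm}(s)$. $\mathcal J[a^A/x]$ replaces $x$ by the free variable $a^A$. Erasure $|e|$ removes all conversions ($|\mathrm{cv}(t,\alpha)|=|t|$) and replaces assumption sets by a fixed dummy, keeping annotations. Filling: $(\Box\ \mathsf{type})[A]=(A\ \mathsf{type})$,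 $(\Box:A)[t]=(t:A)$, $(A\equiv B\ \mathsf{by}\ \Box)[e]=(A\equiv B\ \mathsf{by}\ \mathrm{asm}(e))$, $(s\equiv t:A\ \mathsf{by}\ \Box)[e]=(s\equiv t:A\ \mathsf{by}\ \mathrm{asm}(e))$, $(\{x{:}A\}\mathcal B)[\{x\}e]=\{x{:}A\}(\mathcal B[e])$; with equations: $(\Box\ \mathsf{type})[A_1\equiv A_2\ \mathsf{by}\ \alpha]=(A_1\equiv A_2\ \mathsf{by}\ \alpha)$, $(\Box:A)[t_1\equiv t_2\ \mathsf{by}\ \alpha]=(t_1\equiv t_2:A\ \mathsf{by}\ \alpha)$, commuting with abstraction. An instantiation $I=\langle M_1^{\mathcal B_1}\mapsto e_1,\dots,M_n^{\mathcal B_n}\mapsto e_n\rangle$ requires $\mathrm{mv}(\mathcal B_i)\subseteq\{M_1^{\mathcal B_1},\dots,M_{i-1}^{\mathcal B_{i-1}}\}$ and matching arities; $I_*(M_i^{\mathcal B_i}(\vec t))=e_i'[I_*\vec t/\vec x]$ where $e_i=\{\vec x\}e_i'$, $I_*a^A=a^{I_*A}$, $I_*\mathrm{cv}(t,\alpha)=\mathrm{cv}(I_*t,I_*\alpha)$, $I_*\alpha=\bigcup\{\mathrm{asm}(e_i):M_i^{\mathcal B_i}\in\alpha\}\cup\{x: x\in\alpha\}\cup\{a^{I_*A}:a^A\in\alpha\}$, homomorphic elsewhere; $I_{(i)}$ is the restriction to the first $i-1$ metavariables. Rules. A context-free raw rule is $M_1^{\mathcal B_1},\dots,M_n^{\mathcal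 B_n}\Longrightarrow\mathcal J$ with $\mathcal B_i$ and $\mathcal J$ closed (no free variables), $\mathcal J$ non-abstracted, $\mathrm{mv}(\mathcal B_i)\subseteq\{M_1^{\mathcal B_1},\dots,M_{i-1}^{\mathcal B_{i-1}}\}$ and $\mathrm{mv}(\mathcal J)=\{M_1^{\mathcal B_1},\dots,M_n^{\mathcal B_n}\}$. In a closure rule with premises $p_1,\dots,p_k$ and equality conclusion $\beta[\alpha]$, "$\alpha$ suitable" means $\mathrm{asm}(p_1,\dots,p_k)=\mathrm{asm}(\beta[\alpha])$. A context-free raw type theory $T$ is a family of such rules; $\vdash_T$ denotes membership in the least set of judgements and boundaries closed under: (CF-Var) $\vdash a^A:A$; (CF-Abstr) from $\vdash A\ \mathsf{type}$ and $\vdash\mathcal J[a^A/x]$ with $a^A\notin\mathrm{fv}(\mathcal J)$ infer $\vdash\{x{:}A\}\mathcal J$; (CF-Meta) for $\mathcal B=\{x_1{:}A_1\}\cdots\{x_n{:}A_n\}\beta$: from $\vdash t_i:A_i[t_1,\dots,t_{i-1}/x_1,\dots,x_{i-1}]$ ($i=1..n$) and $\vdash\beta[\vec t/\vec x]$ infer $\vdash(\beta[\vec t/\vec x])[M^{\mathcal B}(\vec t)]$ (for equality $\beta$ the assumption set is $\mathrm{asm}(M^{\mathcal B}(\vec t))$); (CF-Meta-Congr) for $\mathcal B=\{x_1{:}A_1\}\cdots\{x_m{:}A_m\}\beta$ with $\beta$ a type or term boundary: from $\vdash s_j:A_j[\vec s_{<j}/\vec x_{<j}]$, $\vdash t_j:A_j[\vec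 t_{<j}/\vec x_{<j}]$, and $\vdash s_j\equiv t'_j:A_j[\vec s_{<j}/\vec x_{<j}]\ \mathsf{by}\ \alpha_j$ with $|t'_j|=|t_j|$ ($j=1..m$), infer $\vdash M^{\mathcal B}(\vec s)\equiv M^{\mathcal B}(\vec t)\ \mathsf{by}\ \gamma$ if $\beta=\Box\ \mathsf{type}$, and, if $\beta=(\Box:B)$, given also $\vdash v:B[\vec s/\vec x]$ with $|v|=|M^{\mathcal B}(\vec t)|$, infer $\vdash M^{\mathcal B}(\vec s)\equiv v:B[\vec s/\vec x]\ \mathsf{by}\ \gamma$ ($\gamma$ suitable); (equality) from $\vdash A_1\ \mathsf{type}$, $\vdash A_2\ \mathsf{type}$, $|A_1|=|A_2|$ infer $\vdash A_1\equiv A_2\ \mathsf{by}\ \emptyset$; from $\vdash t_1:A$, $\vdash t_2:A$, $|t_1|=|t_2|$ infer $\vdash t_1\equiv t_2:A\ \mathsf{by}\ \emptyset$; symmetry keeping the assumption set; transitivity: from $\vdash A\equiv B\ \mathsf{by}\ \alpha$ and $\vdash B'\equiv C\ \mathsf{by}\ \beta$ with $|B|=|B'|$ infer $\vdash A\equiv C\ \mathsf{by}\ \gamma$ ($\gamma$ suitable), likewise for terms at a common type $A$ with $|t|=|t'|$; (CF-Conv-Tm) from $\vdash t:A$ and $\vdash A\equiv B\ \mathsf{by}\ \alpha$ infer $\vdash\mathrm{cv}(t,\beta):B$ whenever $\mathrm{asm}(t,A,B,\alpha)=\mathrm{asm}(t,B,\beta)$; (CF-Conv-EqTm) from $\vdash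 s\equiv t:A\ \mathsf{by}\ \alpha$ and $\vdash A\equiv B\ \mathsf{by}\ \beta$ infer $\vdash\mathrm{cv}(s,\gamma)\equiv\mathrm{cv}(t,\delta):B\ \mathsf{by}\ \alpha$ whenever $\mathrm{asm}(s,A,B,\beta)=\mathrm{asm}(s,B,\gamma)$ and $\mathrm{asm}(t,A,B,\beta)=\mathrm{asm}(t,B,\delta)$; (boundaries) $\vdash\Box\ \mathsf{type}$; $\vdash\Box:A$ from $\vdash A\ \mathsf{type}$; $\vdash A\equiv B\ \mathsf{by}\ \Box$ from $\vdash A\ \mathsf{type}$, $\vdash B\ \mathsf{type}$; $\vdash s\equiv t:A\ \mathsf{by}\ \Box$ from $\vdash A\ \mathsf{type}$, $\vdash s:A$, $\vdash t:A$; $\vdash\{x{:}A\}\mathcal B$ from $\vdash A\ \mathsf{type}$ and $\vdash\mathcal B[a^A/x]$ with $a^A\notin\mathrm{fv}(\mathcal B)$; (specific rules) for a specific rule $M_1^{\mathcal B_1},\dots,M_n^{\mathcal B_n}\Longrightarrow\beta[e]$ and instantiation $I=\langle M_i^{\mathcal B_i}\mapsto e_i\rangle$: from $\vdash(I_{(i)*}\mathcal B_i)[e_i]$ ($i=1..n$) and $\vdash I_*\beta$ infer $\vdash I_*(\beta[e])$; (congruence) for a specific rule with conclusion $A\ \mathsf{type}$ (resp. $t:A$) and instantiations $I=\langle M_i\mapsto f_i\rangle$, $J=\langle M_i\mapsto g_i\rangle$: from $\vdash(I_{(i)*}\mathcal B_i)[f_i]$, $\vdash(J_{(i)*}\mathcal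 B_i)[g_i]$ for all $i$, and for each type/term boundary $\mathcal B_i$ some $g'_i$ with $|g'_i|=|g_i|$ and $\vdash(I_{(i)*}\mathcal B_i)[f_i\equiv g'_i\ \mathsf{by}\ \alpha_i]$, infer $\vdash I_*A\equiv J_*A\ \mathsf{by}\ \gamma$ (resp., given also $\vdash t':I_*A$ with $|t'|=|J_*t|$, infer $\vdash I_*t\equiv t':I_*A\ \mathsf{by}\ \gamma$), $\gamma$ suitable. *)

theory Defs
  imports "HOL-Library.FSet"
begin

section \<open>Raw syntax\<close>

text \<open>
  Bound variables are de Bruijn indices, so expressions are identified up to renaming of bound
  variables. Types, terms, assumption sets and abstractions share one datatype; the predicate
  \<open>wf_expr\<close> below carves out the syntactic classes, the arities, and the scoping discipline.
\<close>

datatype eclass = Ty | Tm | EqTy | EqTm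

type_synonym arity = "eclass \<times> nat"

type_synonym 's signature = "'s \<Rightarrow> eclass \<times> arity list"

datatype 's expr =
    Fv nat "'s expr"
  | Bv nat
  | Sym 's "'s expr list"
  | Mv nat "'s bdry" "'s expr list"
  | Cv "'s expr" "'s atom fset"
  | Asm "'s atom fset"
  | Abs "'s expr"
and 's atom =
    AFv nat "'s expr"
  | ABv nat
  | AMv nat "'s bdry"
and 's bdry =
    BTy
  | BTm "'s expr"
  | BEqTy "'s expr" "'s expr"
  | BEqTm "'s expr" "'s expr" "'s expr"
  | BAbs "'s expr" "'s bdry"

text \<open>\<open>BEqTm s t A\<close> is the boundary \<open>s \<equiv> t : A by \<box>\<close>, and \<open>JEqTm s t A \<alpha>\<close> the thesis
  \<open>s \<equiv> t : A by \<alpha>\<close>.\<close>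

datatype 's jdg =
    JTy "'s expr"
  | JTm "'s expr" "'s expr"
  | JEqTy "'s expr" "'s expr" "'s atom fset"
  | JEqTm "'s expr" "'s expr" "'s expr" "'s atom fset"
  | JAbs "'s expr" "'s jdg"

primrec arity_of :: "'s bdry \<Rightarrow> arity" where
  "arity_of BTy = (Ty, 0)"
| "arity_of (BTm A) = (Tm, 0)"
| "arity_of (BEqTy A B) = (EqTy, 0)"
| "arity_of (BEqTm s t A) = (EqTm, 0)"
| "arity_of (BAbs A \<B>) = (fst (arity_of \<B>), Suc (snd (arity_of \<B>)))"

definition object_bdry :: "'s bdry \<Rightarrow> bool" where
  "object_bdry \<B> \<longleftrightarrow> fst (arity_of \<B>) \<in> {Ty, Tm}"

text \<open>For \<open>\<B> = {x\<^sub>1:A\<^sub>1}\<dots>{x\<^sub>m:A\<^sub>m}\<beta>\<close>, \<open>tele \<B> = [A\<^sub>1, \<dots>, A\<^sub>m]\<close> (with \<open>A\<^sub>i\<close> in the scope of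
  \<open>i - 1\<close> bound variables) and \<open>core \<B> = \<beta>\<close>.\<close>

primrec tele :: "'s bdry \<Rightarrow> 's expr list" where
  "tele BTy = []"
| "tele (BTm A) = []"
| "tele (BEqTy A B) = []"
| "tele (BEqTm s t A) = []"
| "tele (BAbs A \<B>) = A # tele \<B>"

primrec core :: "'s bdry \<Rightarrow> 's bdry" where
  "core BTy = BTy"
| "core (BTm A) = BTm A"
| "core (BEqTy A B) = BEqTy A B"
| "core (BEqTm s t A) = BEqTm s t A"
| "core (BAbs A \<B>) = core \<B>"

section \<open>Occurrences\<close>

text \<open>\<open>unbind\<close> leaves the scope of one binder: the innermost index is dropped, the others are
  decremented. Annotations are closed and hence unaffected.\<close>

primrec atom_down :: "'s atom \<Rightarrow> 's atom" where
  "atom_down (AFv a A) = AFv a A"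
| "atom_down (ABv n) = ABv (n - 1)"
| "atom_down (AMv M \<B>) = AMv M \<B>"

definition unbind :: "'s atom fset \<Rightarrow> 's atom fset" where
  "unbind \<alpha> = atom_down |`| (\<alpha> |-| {|ABv 0|})"

primrec asm :: "'s expr \<Rightarrow> 's atom fset"
  and asm_atom :: "'s atom \<Rightarrow> 's atom fset"
  and asm_bdry :: "'s bdry \<Rightarrow> 's atom fset" where
  "asm (Fv a A) = finsert (AFv a A) (asm A)"
| "asm (Bv n) = {|ABv n|}"
| "asm (Sym S es) = ffUnion (fset_of_list (map asm es))"
| "asm (Mv M \<B> ts) = finsert (AMv M \<B>) (asm_bdry \<B> |\<union>| ffUnion (fset_of_list (map asm ts)))"
| "asm (Cv t \<alpha>) = asm t |\<union>| ffUnion (asm_atom |`| \<alpha>)"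
| "asm (Asm \<alpha>) = ffUnion (asm_atom |`| \<alpha>)"
| "asm (Abs e) = unbind (asm e)"
| "asm_atom (AFv a A) = finsert (AFv a A) (asm A)"
| "asm_atom (ABv n) = {|ABv n|}"
| "asm_atom (AMv M \<B>) = finsert (AMv M \<B>) (asm_bdry \<B>)"
| "asm_bdry BTy = {||}"
| "asm_bdry (BTm A) = asm A"
| "asm_bdry (BEqTy A B) = asm A |\<union>| asm B"
| "asm_bdry (BEqTm s t A) = asm s |\<union>| asm t |\<union>| asm A"
| "asm_bdry (BAbs A \<B>) = asm A |\<union>| unbind (asm_bdry \<B>)"

primrec asm_jdg :: "'s jdg \<Rightarrow> 's atom fset" where
  "asm_jdg (JTy A) = asm A"
| "asm_jdg (JTm t A) = asm t |\<union>| asm A"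
| "asm_jdg (JEqTy A B \<alpha>) = asm A |\<union>| asm B |\<union>| asm (Asm \<alpha>)"
| "asm_jdg (JEqTm s t A \<alpha>) = asm s |\<union>| asm t |\<union>| asm A |\<union>| asm (Asm \<alpha>)"
| "asm_jdg (JAbs A \<J>) = asm A |\<union>| unbind (asm_jdg \<J>)"

definition asm_jdgs :: "'s jdg list \<Rightarrow> 's atom fset" where
  "asm_jdgs \<J>s = ffUnion (fset_of_list (map asm_jdg \<J>s))"

definition fv_bdry :: "'s bdry \<Rightarrow> (nat \<times> 's expr) set" where
  "fv_bdry \<B> = {(a, A). AFv a A |\<in>| asm_bdry \<B>}"

definition mv_bdry :: "'s bdry \<Rightarrow> (nat \<times> 's bdry) set" where
  "mv_bdry \<B> = {(M, \<B>'). AMv M \<B>' |\<in>| asm_bdry \<B>}"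

definition fv_jdg :: "'s jdg \<Rightarrow> (nat \<times> 's expr) set" where
  "fv_jdg \<J> = {(a, A). AFv a A |\<in>| asm_jdg \<J>}"

definition mv_jdg :: "'s jdg \<Rightarrow> (nat \<times> 's bdry) set" where
  "mv_jdg \<J> = {(M, \<B>). AMv M \<B> |\<in>| asm_jdg \<J>}"

section \<open>Well-formed syntax over a signature\<close>

text \<open>\<open>wf_expr \<Sigma> k (c, n) e\<close>: \<open>e\<close> is an argument of class \<open>c\<close> binding \<open>n\<close> variables, whose unbound
  bound variables are among the indices below \<open>k\<close>. Metavariables of an equality class do not head
  expressions; they occur in assumption sets only.\<close>

inductive wf_expr :: "'s signature \<Rightarrow> nat \<Rightarrow> arity \<Rightarrow> 's expr \<Rightarrow> bool"
  and wf_atom :: "'s signature \<Rightarrow> nat \<Rightarrow> 's atom \<Rightarrow> bool"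
  and wf_bdry :: "'s signature \<Rightarrow> nat \<Rightarrow> 's bdry \<Rightarrow> bool"
  for \<Sigma> :: "'s signature" where
  "wf_expr \<Sigma> 0 (Ty, 0) A \<Longrightarrow> wf_expr \<Sigma> k (Tm, 0) (Fv a A)"
| "n < k \<Longrightarrow> wf_expr \<Sigma> k (Tm, 0) (Bv n)"
| "\<lbrakk>\<Sigma> S = (c, ars); list_all2 (wf_expr \<Sigma> k) ars es\<rbrakk> \<Longrightarrow> wf_expr \<Sigma> k (c, 0) (Sym S es)"
| "\<lbrakk>wf_bdry \<Sigma> 0 \<B>; fv_bdry \<B> = {}; arity_of \<B> = (c, length ts); c \<in> {Ty, Tm};
    list_all (wf_expr \<Sigma> k (Tm, 0)) ts\<rbrakk> \<Longrightarrow> wf_expr \<Sigma> k (c, 0) (Mv M \<B> ts)"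
| "\<lbrakk>wf_expr \<Sigma> k (Tm, 0) t; \<forall>x. x |\<in>| \<alpha> \<longrightarrow> wf_atom \<Sigma> k x\<rbrakk> \<Longrightarrow> wf_expr \<Sigma> k (Tm, 0) (Cv t \<alpha>)"
| "\<lbrakk>c \<in> {EqTy, EqTm}; \<forall>x. x |\<in>| \<alpha> \<longrightarrow> wf_atom \<Sigma> k x\<rbrakk> \<Longrightarrow> wf_expr \<Sigma> k (c, 0) (Asm \<alpha>)"
| "wf_expr \<Sigma> (Suc k) (c, n) e \<Longrightarrow> wf_expr \<Sigma> k (c, Suc n) (Abs e)"
| "wf_expr \<Sigma> 0 (Ty, 0) A \<Longrightarrow> wf_atom \<Sigma> k (AFv a A)"
| "n < k \<Longrightarrow> wf_atom \<Sigma> k (ABv n)"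
| "\<lbrakk>wf_bdry \<Sigma> 0 \<B>; fv_bdry \<B> = {}\<rbrakk> \<Longrightarrow> wf_atom \<Sigma> k (AMv M \<B>)"
| "wf_bdry \<Sigma> k BTy"
| "wf_expr \<Sigma> k (Ty, 0) A \<Longrightarrow> wf_bdry \<Sigma> k (BTm A)"
| "\<lbrakk>wf_expr \<Sigma> k (Ty, 0) A; wf_expr \<Sigma> k (Ty, 0) B\<rbrakk> \<Longrightarrow> wf_bdry \<Sigma> k (BEqTy A B)"
| "\<lbrakk>wf_expr \<Sigma> k (Tm, 0) s; wf_expr \<Sigma> k (Tm, 0) t; wf_expr \<Sigma> k (Ty, 0) A\<rbrakk>
    \<Longrightarrow> wf_bdry \<Sigma> k (BEqTm s t A)"
| "\<lbrakk>wf_expr \<Sigma> k (Ty, 0) A; wf_bdry \<Sigma> (Suc k) \<B>\<rbrakk> \<Longrightarrow> wf_bdry \<Sigma> k (BAbs A \<B>)"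

primrec wf_jdg :: "'s signature \<Rightarrow> nat \<Rightarrow> 's jdg \<Rightarrow> bool" where
  "wf_jdg \<Sigma> k (JTy A) \<longleftrightarrow> wf_expr \<Sigma> k (Ty, 0) A"
| "wf_jdg \<Sigma> k (JTm t A) \<longleftrightarrow> wf_expr \<Sigma> k (Tm, 0) t \<and> wf_expr \<Sigma> k (Ty, 0) A"
| "wf_jdg \<Sigma> k (JEqTy A B \<alpha>) \<longleftrightarrow>
    wf_expr \<Sigma> k (Ty, 0) A \<and> wf_expr \<Sigma> k (Ty, 0) B \<and> wf_expr \<Sigma> k (EqTy, 0) (Asm \<alpha>)"
| "wf_jdg \<Sigma> k (JEqTm s t A \<alpha>) \<longleftrightarrow>
    wf_expr \<Sigma> k (Tm, 0) s \<and> wf_expr \<Sigma> k (Tm, 0) t \<and> wf_expr \<Sigma> k (Ty, 0) A \<and>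
    wf_expr \<Sigma> k (EqTm, 0) (Asm \<alpha>)"
| "wf_jdg \<Sigma> k (JAbs A \<J>) \<longleftrightarrow> wf_expr \<Sigma> k (Ty, 0) A \<and> wf_jdg \<Sigma> (Suc k) \<J>"

section \<open>Substitution, erasure, filling\<close>

text \<open>Type annotations and boundary annotations have no unbound bound variables, so lifting and
  substitution do not descend into them.\<close>

primrec lift_atom :: "nat \<Rightarrow> 's atom \<Rightarrow> 's atom" where
  "lift_atom k (AFv a A) = AFv a A"
| "lift_atom k (ABv n) = ABv (if n < k then n else Suc n)"
| "lift_atom k (AMv M \<B>) = AMv M \<B>"

primrec lift :: "nat \<Rightarrow> 's expr \<Rightarrow> 's expr" where
  "lift k (Fv a A) = Fv a A"
| "lift k (Bv n) = Bv (if n < k then n else Suc n)"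
| "lift k (Sym S es) = Sym S (map (lift k) es)"
| "lift k (Mv M \<B> ts) = Mv M \<B> (map (lift k) ts)"
| "lift k (Cv t \<alpha>) = Cv (lift k t) (lift_atom k |`| \<alpha>)"
| "lift k (Asm \<alpha>) = Asm (lift_atom k |`| \<alpha>)"
| "lift k (Abs e) = Abs (lift (Suc k) e)"

definition up :: "(nat \<Rightarrow> 's expr) \<Rightarrow> nat \<Rightarrow> 's expr" where
  "up \<sigma> n = (case n of 0 \<Rightarrow> Bv 0 | Suc m \<Rightarrow> lift 0 (\<sigma> m))"

primrec subst_atom :: "(nat \<Rightarrow> 's expr) \<Rightarrow> 's atom \<Rightarrow> 's atom fset" where
  "subst_atom \<sigma> (AFv a A) = {|AFv a A|}"
| "subst_atom \<sigma> (ABv n) = asm (\<sigma> n)"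
| "subst_atom \<sigma> (AMv M \<B>) = {|AMv M \<B>|}"

definition subst_asm :: "(nat \<Rightarrow> 's expr) \<Rightarrow> 's atom fset \<Rightarrow> 's atom fset" where
  "subst_asm \<sigma> \<alpha> = ffUnion (subst_atom \<sigma> |`| \<alpha>)"

primrec subst :: "(nat \<Rightarrow> 's expr) \<Rightarrow> 's expr \<Rightarrow> 's expr" where
  "subst \<sigma> (Fv a A) = Fv a A"
| "subst \<sigma> (Bv n) = \<sigma> n"
| "subst \<sigma> (Sym S es) = Sym S (map (subst \<sigma>) es)"
| "subst \<sigma> (Mv M \<B> ts) = Mv M \<B> (map (subst \<sigma>) ts)"
| "subst \<sigma> (Cv t \<alpha>) = Cv (subst \<sigma> t) (subst_asm \<sigma> \<alpha>)"
| "subst \<sigma> (Asm \<alpha>) = Asm (subst_asm \<sigma> \<alpha>)"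
| "subst \<sigma> (Abs e) = Abs (subst (up \<sigma>) e)"

primrec subst_bdry :: "(nat \<Rightarrow> 's expr) \<Rightarrow> 's bdry \<Rightarrow> 's bdry" where
  "subst_bdry \<sigma> BTy = BTy"
| "subst_bdry \<sigma> (BTm A) = BTm (subst \<sigma> A)"
| "subst_bdry \<sigma> (BEqTy A B) = BEqTy (subst \<sigma> A) (subst \<sigma> B)"
| "subst_bdry \<sigma> (BEqTm s t A) = BEqTm (subst \<sigma> s) (subst \<sigma> t) (subst \<sigma> A)"
| "subst_bdry \<sigma> (BAbs A \<B>) = BAbs (subst \<sigma> A) (subst_bdry (up \<sigma>) \<B>)"

primrec subst_jdg :: "(nat \<Rightarrow> 's expr) \<Rightarrow> 's jdg \<Rightarrow> 's jdg" where
  "subst_jdg \<sigma> (JTy A) = JTy (subst \<sigma> A)"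
| "subst_jdg \<sigma> (JTm t A) = JTm (subst \<sigma> t) (subst \<sigma> A)"
| "subst_jdg \<sigma> (JEqTy A B \<alpha>) = JEqTy (subst \<sigma> A) (subst \<sigma> B) (subst_asm \<sigma> \<alpha>)"
| "subst_jdg \<sigma> (JEqTm s t A \<alpha>) =
    JEqTm (subst \<sigma> s) (subst \<sigma> t) (subst \<sigma> A) (subst_asm \<sigma> \<alpha>)"
| "subst_jdg \<sigma> (JAbs A \<J>) = JAbs (subst \<sigma> A) (subst_jdg (up \<sigma>) \<J>)"

text \<open>\<open>inst [t\<^sub>1, \<dots>, t\<^sub>m]\<close> is the simultaneous substitution \<open>[t\<^sub>1, \<dots>, t\<^sub>m / x\<^sub>1, \<dots>, x\<^sub>m]\<close> where \<open>x\<^sub>m\<close>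
  is the innermost bound variable, i.e. has index \<open>0\<close>.\<close>

definition inst :: "'s expr list \<Rightarrow> nat \<Rightarrow> 's expr" where
  "inst ts n = (if n < length ts then rev ts ! n else Bv (n - length ts))"

text \<open>The empty assumption set serves as the dummy.\<close>

primrec erase :: "'s expr \<Rightarrow> 's expr" where
  "erase (Fv a A) = Fv a A"
| "erase (Bv n) = Bv n"
| "erase (Sym S es) = Sym S (map erase es)"
| "erase (Mv M \<B> ts) = Mv M \<B> (map erase ts)"
| "erase (Cv t \<alpha>) = erase t"
| "erase (Asm \<alpha>) = Asm {||}"
| "erase (Abs e) = Abs (erase e)"

text \<open>Filling is meaningful only for heads matching the arity of the boundary.\<close>

fun fill :: "'s bdry \<Rightarrow> 's expr \<Rightarrow> 's jdg" where
  "fill BTy A = JTy A"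
| "fill (BTm A) t = JTm t A"
| "fill (BEqTy A B) e = JEqTy A B (asm e)"
| "fill (BEqTm s t A) e = JEqTm s t A (asm e)"
| "fill (BAbs A \<B>) (Abs e) = JAbs A (fill \<B> e)"

fun fill_eq :: "'s bdry \<Rightarrow> 's expr \<Rightarrow> 's expr \<Rightarrow> 's atom fset \<Rightarrow> 's jdg" where
  "fill_eq BTy A\<^sub>1 A\<^sub>2 \<alpha> = JEqTy A\<^sub>1 A\<^sub>2 \<alpha>"
| "fill_eq (BTm A) t\<^sub>1 t\<^sub>2 \<alpha> = JEqTm t\<^sub>1 t\<^sub>2 A \<alpha>"
| "fill_eq (BAbs A \<B>) (Abs e\<^sub>1) (Abs e\<^sub>2) \<alpha> = JAbs A (fill_eq \<B> e\<^sub>1 e\<^sub>2 \<alpha>)"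

primrec bdry_of :: "'s jdg \<Rightarrow> 's bdry" where
  "bdry_of (JTy A) = BTy"
| "bdry_of (JTm t A) = BTm A"
| "bdry_of (JEqTy A B \<alpha>) = BEqTy A B"
| "bdry_of (JEqTm s t A \<alpha>) = BEqTm s t A"
| "bdry_of (JAbs A \<J>) = BAbs A (bdry_of \<J>)"

lemma bdry_of_fill: "wf_expr \<Sigma> k (arity_of \<B>) e \<Longrightarrow> bdry_of (fill \<B> e) = \<B>"
  by (induction \<B> e arbitrary: k rule: fill.induct) (auto elim: wf_expr.cases)

section \<open>Instantiations\<close>

type_synonym 's mvar = "nat \<times> 's bdry"

type_synonym 's instn = "('s mvar \<times> 's expr) list"

fun unabs :: "nat \<Rightarrow> 's expr \<Rightarrow> 's expr" where
  "unabs 0 e = e"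
| "unabs (Suc n) (Abs e) = unabs n e"

primrec inst_expr :: "'s instn \<Rightarrow> 's expr \<Rightarrow> 's expr"
  and inst_atom :: "'s instn \<Rightarrow> 's atom \<Rightarrow> 's atom fset" where
  "inst_expr I (Fv a A) = Fv a (inst_expr I A)"
| "inst_expr I (Bv n) = Bv n"
| "inst_expr I (Sym S es) = Sym S (map (inst_expr I) es)"
| "inst_expr I (Mv M \<B> ts) =
    (case map_of I (M, \<B>) of
       Some e \<Rightarrow> subst (inst (map (inst_expr I) ts)) (unabs (length ts) e)
     | None \<Rightarrow> Mv M \<B> (map (inst_expr I) ts))"
| "inst_expr I (Cv t \<alpha>) = Cv (inst_expr I t) (ffUnion (inst_atom I |`| \<alpha>))"
| "inst_expr I (Asm \<alpha>) = Asm (ffUnion (inst_atom I |`| \<alpha>))"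
| "inst_expr I (Abs e) = Abs (inst_expr I e)"
| "inst_atom I (AFv a A) = {|AFv a (inst_expr I A)|}"
| "inst_atom I (ABv n) = {|ABv n|}"
| "inst_atom I (AMv M \<B>) = (case map_of I (M, \<B>) of Some e \<Rightarrow> asm e | None \<Rightarrow> {||})"

definition inst_asm :: "'s instn \<Rightarrow> 's atom fset \<Rightarrow> 's atom fset" where
  "inst_asm I \<alpha> = ffUnion (inst_atom I |`| \<alpha>)"

primrec inst_bdry :: "'s instn \<Rightarrow> 's bdry \<Rightarrow> 's bdry" where
  "inst_bdry I BTy = BTy"
| "inst_bdry I (BTm A) = BTm (inst_expr I A)"
| "inst_bdry I (BEqTy A B) = BEqTy (inst_expr I A) (inst_expr I B)"
| "inst_bdry I (BEqTm s t A) = BEqTm (inst_expr I s) (inst_expr I t) (inst_expr I A)"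
| "inst_bdry I (BAbs A \<B>) = BAbs (inst_expr I A) (inst_bdry I \<B>)"

primrec inst_jdg :: "'s instn \<Rightarrow> 's jdg \<Rightarrow> 's jdg" where
  "inst_jdg I (JTy A) = JTy (inst_expr I A)"
| "inst_jdg I (JTm t A) = JTm (inst_expr I t) (inst_expr I A)"
| "inst_jdg I (JEqTy A B \<alpha>) = JEqTy (inst_expr I A) (inst_expr I B) (inst_asm I \<alpha>)"
| "inst_jdg I (JEqTm s t A \<alpha>) =
    JEqTm (inst_expr I s) (inst_expr I t) (inst_expr I A) (inst_asm I \<alpha>)"
| "inst_jdg I (JAbs A \<J>) = JAbs (inst_expr I A) (inst_jdg I \<J>)"

definition wf_mvars :: "'s signature \<Rightarrow> 's mvar list \<Rightarrow> bool" where
  "wf_mvars \<Sigma> Ms \<longleftrightarrow>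
    (\<forall>i < length Ms. wf_bdry \<Sigma> 0 (snd (Ms ! i)) \<and> fv_bdry (snd (Ms ! i)) = {} \<and>
       mv_bdry (snd (Ms ! i)) \<subseteq> set (take i Ms))"

text \<open>An instantiation is a map, so its metavariables are pairwise distinct (as annotated
  metavariables).\<close>

definition instantiation_of :: "'s signature \<Rightarrow> 's mvar list \<Rightarrow> 's instn \<Rightarrow> bool" where
  "instantiation_of \<Sigma> Ms I \<longleftrightarrow>
    map fst I = Ms \<and> distinct Ms \<and> wf_mvars \<Sigma> Ms \<and>
    (\<forall>((M, \<B>), e) \<in> set I. wf_expr \<Sigma> 0 (arity_of \<B>) e)"

section \<open>Raw rules and raw type theories\<close>

type_synonym 's rule = "'s mvar list \<times> 's jdg"

definition raw_rule :: "'s signature \<Rightarrow> 's rule \<Rightarrow> bool" where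
  "raw_rule \<Sigma> R \<longleftrightarrow>
    (case R of (Ms, \<J>) \<Rightarrow>
      wf_mvars \<Sigma> Ms \<and> wf_jdg \<Sigma> 0 \<J> \<and> fv_jdg \<J> = {} \<and> (\<nexists>A \<J>'. \<J> = JAbs A \<J>') \<and>
      mv_jdg \<J> = set Ms)"

definition raw_type_theory :: "'s signature \<Rightarrow> 's rule set \<Rightarrow> bool" where
  "raw_type_theory \<Sigma> T \<longleftrightarrow> (\<forall>S. fst (\<Sigma> S) \<in> {Ty, Tm}) \<and> (\<forall>R \<in> T. raw_rule \<Sigma> R)"

text \<open>The judgements \<open>t\<^sub>i : A\<^sub>i[t\<^sub>1, \<dots>, t\<^sub>i\<^sub>-\<^sub>1 / x\<^sub>1, \<dots>, x\<^sub>i\<^sub>-\<^sub>1]\<close>, and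
  \<open>s\<^sub>i \<equiv> t'\<^sub>i : A\<^sub>i[s\<^sub>1, \<dots>, s\<^sub>i\<^sub>-\<^sub>1 / x\<^sub>1, \<dots>, x\<^sub>i\<^sub>-\<^sub>1] by \<alpha>\<^sub>i\<close>, for \<open>tele \<B> = [A\<^sub>1, \<dots>, A\<^sub>m]\<close>.\<close>

definition args_jdgs :: "'s bdry \<Rightarrow> 's expr list \<Rightarrow> 's jdg list" where
  "args_jdgs \<B> ts =
    map (\<lambda>i. JTm (ts ! i) (subst (inst (take i ts)) (tele \<B> ! i))) [0..<length (tele \<B>)]"

definition args_eq_jdgs ::
    "'s bdry \<Rightarrow> 's expr list \<Rightarrow> (nat \<Rightarrow> 's expr) \<Rightarrow> (nat \<Rightarrow> 's atom fset) \<Rightarrow> 's jdg list" where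
  "args_eq_jdgs \<B> ss t' \<alpha> =
    map (\<lambda>i. JEqTm (ss ! i) (t' i) (subst (inst (take i ss)) (tele \<B> ! i)) (\<alpha> i))
      [0..<length (tele \<B>)]"

text \<open>The judgements \<open>(I\<^sub>(\<^sub>i\<^sub>)\<^sub>*\<B>\<^sub>i)[e\<^sub>i]\<close>, and \<open>(I\<^sub>(\<^sub>i\<^sub>)\<^sub>*\<B>\<^sub>i)[f\<^sub>i \<equiv> g'\<^sub>i by \<alpha>\<^sub>i]\<close> for the type and term
  boundaries \<open>\<B>\<^sub>i\<close>.\<close>

definition instn_bdry :: "'s instn \<Rightarrow> nat \<Rightarrow> 's bdry" where
  "instn_bdry I i = inst_bdry (take i I) (snd (fst (I ! i)))"

definition instn_jdgs :: "'s instn \<Rightarrow> 's jdg list" where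
  "instn_jdgs I = map (\<lambda>i. fill (instn_bdry I i) (snd (I ! i))) [0..<length I]"

definition object_indices :: "'s instn \<Rightarrow> nat list" where
  "object_indices I = filter (\<lambda>i. object_bdry (snd (fst (I ! i)))) [0..<length I]"

definition instn_eq_jdgs ::
    "'s instn \<Rightarrow> (nat \<Rightarrow> 's expr) \<Rightarrow> (nat \<Rightarrow> 's atom fset) \<Rightarrow> 's jdg list" where
  "instn_eq_jdgs I g' \<alpha> =
    map (\<lambda>i. fill_eq (instn_bdry I i) (snd (I ! i)) (g' i) (\<alpha> i)) (object_indices I)"

definition suitable :: "'s jdg list \<Rightarrow> 's jdg \<Rightarrow> bool" where
  "suitable \<J>s \<J> \<longleftrightarrow> asm_jdgs \<J>s = asm_jdg \<J>"

section \<open>Derivability\<close>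

text \<open>
  The premises \<open>wf_jdg \<Sigma> 0 \<dots>\<close> and \<open>wf_bdry \<Sigma> 0 \<dots>\<close> on conclusions confine the rules to
  well-formed syntax over \<open>\<Sigma>\<close>. A specific rule \<open>\<dots> \<Longrightarrow> \<beta>[e]\<close> is represented by its conclusion
  \<open>\<J> = \<beta>[e]\<close>, with \<open>\<beta> = bdry_of \<J>\<close> (cf. \<open>bdry_of_fill\<close>).
\<close>

inductive deriv_jdg :: "'s signature \<Rightarrow> 's rule set \<Rightarrow> 's jdg \<Rightarrow> bool"
  and deriv_bdry :: "'s signature \<Rightarrow> 's rule set \<Rightarrow> 's bdry \<Rightarrow> bool"
  for \<Sigma> :: "'s signature" and T :: "'s rule set" where
  cf_var:
    "wf_jdg \<Sigma> 0 (JTm (Fv a A) A) \<Longrightarrow> deriv_jdg \<Sigma> T (JTm (Fv a A) A)"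
| cf_abstr:
    "\<lbrakk>deriv_jdg \<Sigma> T (JTy A); deriv_jdg \<Sigma> T (subst_jdg (inst [Fv a A]) \<J>); (a, A) \<notin> fv_jdg \<J>;
      wf_jdg \<Sigma> 0 (JAbs A \<J>)\<rbrakk>
     \<Longrightarrow> deriv_jdg \<Sigma> T (JAbs A \<J>)"
| cf_meta:
    "\<lbrakk>length ts = length (tele \<B>); \<forall>\<J> \<in> set (args_jdgs \<B> ts). deriv_jdg \<Sigma> T \<J>;
      deriv_bdry \<Sigma> T (subst_bdry (inst ts) (core \<B>));
      wf_jdg \<Sigma> 0 (fill (subst_bdry (inst ts) (core \<B>)) (Mv M \<B> ts))\<rbrakk>
     \<Longrightarrow> deriv_jdg \<Sigma> T (fill (subst_bdry (inst ts) (core \<B>)) (Mv M \<B> ts))"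
| cf_meta_congr_ty:
    "\<lbrakk>core \<B> = BTy; length ss = length (tele \<B>); length ts = length (tele \<B>);
      \<forall>i < length ts. erase (t' i) = erase (ts ! i);
      Ps = args_jdgs \<B> ss @ args_jdgs \<B> ts @ args_eq_jdgs \<B> ss t' \<alpha>;
      \<forall>\<J> \<in> set Ps. deriv_jdg \<Sigma> T \<J>;
      suitable Ps (JEqTy (Mv M \<B> ss) (Mv M \<B> ts) \<gamma>);
      wf_jdg \<Sigma> 0 (JEqTy (Mv M \<B> ss) (Mv M \<B> ts) \<gamma>)\<rbrakk>
     \<Longrightarrow> deriv_jdg \<Sigma> T (JEqTy (Mv M \<B> ss) (Mv M \<B> ts) \<gamma>)"
| cf_meta_congr_tm:
    "\<lbrakk>core \<B> = BTm B; length ss = length (tele \<B>); length ts = length (tele \<B>);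
      \<forall>i < length ts. erase (t' i) = erase (ts ! i); erase v = erase (Mv M \<B> ts);
      Ps = args_jdgs \<B> ss @ args_jdgs \<B> ts @ args_eq_jdgs \<B> ss t' \<alpha> @ [JTm v (subst (inst ss) B)];
      \<forall>\<J> \<in> set Ps. deriv_jdg \<Sigma> T \<J>;
      suitable Ps (JEqTm (Mv M \<B> ss) v (subst (inst ss) B) \<gamma>);
      wf_jdg \<Sigma> 0 (JEqTm (Mv M \<B> ss) v (subst (inst ss) B) \<gamma>)\<rbrakk>
     \<Longrightarrow> deriv_jdg \<Sigma> T (JEqTm (Mv M \<B> ss) v (subst (inst ss) B) \<gamma>)"
| cf_eqty_refl:
    "\<lbrakk>deriv_jdg \<Sigma> T (JTy A\<^sub>1); deriv_jdg \<Sigma> T (JTy A\<^sub>2); erase A\<^sub>1 = erase A\<^sub>2;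
      wf_jdg \<Sigma> 0 (JEqTy A\<^sub>1 A\<^sub>2 {||})\<rbrakk>
     \<Longrightarrow> deriv_jdg \<Sigma> T (JEqTy A\<^sub>1 A\<^sub>2 {||})"
| cf_eqty_sym:
    "\<lbrakk>deriv_jdg \<Sigma> T (JEqTy A B \<alpha>); wf_jdg \<Sigma> 0 (JEqTy B A \<alpha>)\<rbrakk> \<Longrightarrow> deriv_jdg \<Sigma> T (JEqTy B A \<alpha>)"
| cf_eqty_trans:
    "\<lbrakk>deriv_jdg \<Sigma> T (JEqTy A B \<alpha>); deriv_jdg \<Sigma> T (JEqTy B' C \<beta>); erase B = erase B';
      suitable [JEqTy A B \<alpha>, JEqTy B' C \<beta>] (JEqTy A C \<gamma>); wf_jdg \<Sigma> 0 (JEqTy A C \<gamma>)\<rbrakk>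
     \<Longrightarrow> deriv_jdg \<Sigma> T (JEqTy A C \<gamma>)"
| cf_eqtm_refl:
    "\<lbrakk>deriv_jdg \<Sigma> T (JTm t\<^sub>1 A); deriv_jdg \<Sigma> T (JTm t\<^sub>2 A); erase t\<^sub>1 = erase t\<^sub>2;
      wf_jdg \<Sigma> 0 (JEqTm t\<^sub>1 t\<^sub>2 A {||})\<rbrakk>
     \<Longrightarrow> deriv_jdg \<Sigma> T (JEqTm t\<^sub>1 t\<^sub>2 A {||})"
| cf_eqtm_sym:
    "\<lbrakk>deriv_jdg \<Sigma> T (JEqTm s t A \<alpha>); wf_jdg \<Sigma> 0 (JEqTm t s A \<alpha>)\<rbrakk>
     \<Longrightarrow> deriv_jdg \<Sigma> T (JEqTm t s A \<alpha>)"
| cf_eqtm_trans: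
    "\<lbrakk>deriv_jdg \<Sigma> T (JEqTm s t A \<alpha>); deriv_jdg \<Sigma> T (JEqTm t' u A \<beta>); erase t = erase t';
      suitable [JEqTm s t A \<alpha>, JEqTm t' u A \<beta>] (JEqTm s u A \<gamma>); wf_jdg \<Sigma> 0 (JEqTm s u A \<gamma>)\<rbrakk>
     \<Longrightarrow> deriv_jdg \<Sigma> T (JEqTm s u A \<gamma>)"
| cf_conv_tm:
    "\<lbrakk>deriv_jdg \<Sigma> T (JTm t A); deriv_jdg \<Sigma> T (JEqTy A B \<alpha>);
      asm t |\<union>| asm A |\<union>| asm B |\<union>| asm (Asm \<alpha>) = asm t |\<union>| asm B |\<union>| asm (Asm \<beta>);
      wf_jdg \<Sigma> 0 (JTm (Cv t \<beta>) B)\<rbrakk>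
     \<Longrightarrow> deriv_jdg \<Sigma> T (JTm (Cv t \<beta>) B)"
| cf_conv_eqtm:
    "\<lbrakk>deriv_jdg \<Sigma> T (JEqTm s t A \<alpha>); deriv_jdg \<Sigma> T (JEqTy A B \<beta>);
      asm s |\<union>| asm A |\<union>| asm B |\<union>| asm (Asm \<beta>) = asm s |\<union>| asm B |\<union>| asm (Asm \<gamma>);
      asm t |\<union>| asm A |\<union>| asm B |\<union>| asm (Asm \<beta>) = asm t |\<union>| asm B |\<union>| asm (Asm \<delta>);
      wf_jdg \<Sigma> 0 (JEqTm (Cv s \<gamma>) (Cv t \<delta>) B \<alpha>)\<rbrakk>
     \<Longrightarrow> deriv_jdg \<Sigma> T (JEqTm (Cv s \<gamma>) (Cv t \<delta>) B \<alpha>)"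
| cf_specific:
    "\<lbrakk>(Ms, \<J>) \<in> T; instantiation_of \<Sigma> Ms I; \<forall>\<J>' \<in> set (instn_jdgs I). deriv_jdg \<Sigma> T \<J>';
      deriv_bdry \<Sigma> T (inst_bdry I (bdry_of \<J>)); wf_jdg \<Sigma> 0 (inst_jdg I \<J>)\<rbrakk>
     \<Longrightarrow> deriv_jdg \<Sigma> T (inst_jdg I \<J>)"
| cf_congr_ty:
    "\<lbrakk>(Ms, JTy A) \<in> T; instantiation_of \<Sigma> Ms I; instantiation_of \<Sigma> Ms J;
      \<forall>i \<in> set (object_indices I). wf_expr \<Sigma> 0 (arity_of (snd (Ms ! i))) (g' i) \<and>
        erase (g' i) = erase (snd (J ! i));
      Ps = instn_jdgs I @ instn_jdgs J @ instn_eq_jdgs I g' \<alpha>;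
      \<forall>\<J> \<in> set Ps. deriv_jdg \<Sigma> T \<J>;
      suitable Ps (JEqTy (inst_expr I A) (inst_expr J A) \<gamma>);
      wf_jdg \<Sigma> 0 (JEqTy (inst_expr I A) (inst_expr J A) \<gamma>)\<rbrakk>
     \<Longrightarrow> deriv_jdg \<Sigma> T (JEqTy (inst_expr I A) (inst_expr J A) \<gamma>)"
| cf_congr_tm:
    "\<lbrakk>(Ms, JTm t A) \<in> T; instantiation_of \<Sigma> Ms I; instantiation_of \<Sigma> Ms J;
      \<forall>i \<in> set (object_indices I). wf_expr \<Sigma> 0 (arity_of (snd (Ms ! i))) (g' i) \<and>
        erase (g' i) = erase (snd (J ! i));
      erase t' = erase (inst_expr J t);
      Ps = instn_jdgs I @ instn_jdgs J @ instn_eq_jdgs I g' \<alpha> @ [JTm t' (inst_expr I A)];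
      \<forall>\<J> \<in> set Ps. deriv_jdg \<Sigma> T \<J>;
      suitable Ps (JEqTm (inst_expr I t) t' (inst_expr I A) \<gamma>);
      wf_jdg \<Sigma> 0 (JEqTm (inst_expr I t) t' (inst_expr I A) \<gamma>)\<rbrakk>
     \<Longrightarrow> deriv_jdg \<Sigma> T (JEqTm (inst_expr I t) t' (inst_expr I A) \<gamma>)"
| cf_bdry_ty:
    "deriv_bdry \<Sigma> T BTy"
| cf_bdry_tm:
    "deriv_jdg \<Sigma> T (JTy A) \<Longrightarrow> deriv_bdry \<Sigma> T (BTm A)"
| cf_bdry_eqty:
    "\<lbrakk>deriv_jdg \<Sigma> T (JTy A); deriv_jdg \<Sigma> T (JTy B)\<rbrakk> \<Longrightarrow> deriv_bdry \<Sigma> T (BEqTy A B)"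
| cf_bdry_eqtm:
    "\<lbrakk>deriv_jdg \<Sigma> T (JTy A); deriv_jdg \<Sigma> T (JTm s A); deriv_jdg \<Sigma> T (JTm t A)\<rbrakk>
     \<Longrightarrow> deriv_bdry \<Sigma> T (BEqTm s t A)"
| cf_bdry_abstr:
    "\<lbrakk>deriv_jdg \<Sigma> T (JTy A); deriv_bdry \<Sigma> T (subst_bdry (inst [Fv a A]) \<B>); (a, A) \<notin> fv_bdry \<B>;
      wf_bdry \<Sigma> 0 (BAbs A \<B>)\<rbrakk>
     \<Longrightarrow> deriv_bdry \<Sigma> T (BAbs A \<B>)"

definition well_typed_annotations :: "'s signature \<Rightarrow> 's rule set \<Rightarrow> 's jdg \<Rightarrow> bool" where
  "well_typed_annotations \<Sigma> T \<J> \<longleftrightarrow>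
    (\<forall>M \<B>. AMv M \<B> |\<in>| asm_jdg \<J> \<longrightarrow> deriv_bdry \<Sigma> T \<B>) \<and>
    (\<forall>a A. AFv a A |\<in>| asm_jdg \<J> \<longrightarrow> deriv_jdg \<Sigma> T (JTy A))"

end

theory Submission
  imports Defs
begin

text \<open>
  Induction on the derivation. Every closure rule either has the boundary of its conclusion as a
  premise, or has premises whose boundaries contain the required parts; the side conditions on
  assumption sets ensure that an annotation occurring in such a premise already occurs in the
  conclusion, so that the induction hypothesis applies. Only abstraction introduces a new
  annotated variable, and its type is derivable by a premise of the rule.
\<close>

lemma in_ffUnion_fimage: "x |\<in>| ffUnion (f |`| A) \<longleftrightarrow> (\<exists>y. y |\<in>| A \<and> x |\<in>| f y)"
  by (auto simp: ffUnion.rep_eq)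

section \<open>Annotated atoms under substitution\<close>

text \<open>Leaving a binder and lifting renumber bound variables but fix all other atoms, and
  \<open>well_typed_annotations\<close> speaks of the latter. Restricting the occurrence lemmas to
  them avoids index arithmetic.\<close>

primrec annotated :: "'s atom \<Rightarrow> bool" where
  "annotated (AFv a A) \<longleftrightarrow> True"
| "annotated (ABv n) \<longleftrightarrow> False"
| "annotated (AMv M \<B>) \<longleftrightarrow> True"

lemma annotated_atom_down [simp]: "annotated (atom_down x) \<longleftrightarrow> annotated x"
  by (cases x) auto

lemma atom_down_annotated: "annotated x \<Longrightarrow> atom_down x = x"
  by (cases x) auto

lemma annotated_in_unbind:
  assumes x: "annotated x"
  shows "x |\<in>| unbind \<alpha> \<longleftrightarrow> x |\<in>| \<alpha>"
proof
  show "x |\<in>| \<alpha>" if "x |\<in>| unbind \<alpha>"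
    using that x atom_down_annotated by (fastforce simp: unbind_def)
  show "x |\<in>| unbind \<alpha>" if "x |\<in>| \<alpha>"
  proof -
    have "x |\<in>| \<alpha> |-| {|ABv 0|}"
      using that x by auto
    then show ?thesis
      unfolding unbind_def using atom_down_annotated[OF x] by (metis fimage_eqI)
  qed
qed

text \<open>\<open>asm\<close> collects the assumptions inside annotations recursively. A
  substituted assumption set contains elements of some \<open>asm s\<close>, and applying
  \<open>asm\<close> to it closes under annotations once more; no new annotated atom can arise from
  this.\<close>

lemma annotated_asm_trans:
  fixes e :: "'s expr" and z :: "'s atom" and \<B> :: "'s bdry"
  shows "\<lbrakk>y |\<in>| asm e; x |\<in>| asm_atom y; annotated x\<rbrakk> \<Longrightarrow> x |\<in>| asm e"
    and "\<lbrakk>y |\<in>| asm_atom z; x |\<in>| asm_atom y; annotated x\<rbrakk> \<Longrightarrow> x |\<in>| asm_atom z"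
    and "\<lbrakk>y |\<in>| asm_bdry \<B>; x |\<in>| asm_atom y; annotated x\<rbrakk> \<Longrightarrow> x |\<in>| asm_bdry \<B>"
proof (induction e and z and \<B> arbitrary: y and y and y)
  case (Sym S es)
  then show ?case by (fastforce simp: in_ffUnion_fimage fset_of_list_elem)
next
  case (Mv M \<B> ts)
  then show ?case by (fastforce simp: in_ffUnion_fimage fset_of_list_elem)
next
  case (Abs e)
  then obtain y' where "y' |\<in>| asm e" "y = atom_down y'"
    by (auto simp: unbind_def)
  \<comment> \<open>A bound variable \<open>y'\<close> leaves nothing annotated in
    \<open>asm_atom y\<close>; any other \<open>y'\<close> is fixed by
    \<open>atom_down\<close>.\<close>
  with Abs show ?case
    by (cases y') (auto simp: annotated_in_unbind)
next
  case (BAbs A \<B>)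
  show ?case
  proof (cases "y |\<in>| asm A")
    case False
    then obtain y' where "y' |\<in>| asm_bdry \<B>" "y = atom_down y'"
      using BAbs by (auto simp: unbind_def)
    with BAbs show ?thesis
      by (cases y') (auto simp: annotated_in_unbind)
  qed (use BAbs in auto)
qed (fastforce simp: in_ffUnion_fimage)+

lemma annotated_asm_lift_atom:
  "annotated x \<Longrightarrow> x |\<in>| asm_atom (lift_atom k y) \<longleftrightarrow> x |\<in>| asm_atom y"
  by (cases y) auto

lemma annotated_asm_lift: "annotated x \<Longrightarrow> x |\<in>| asm (lift k e) \<longleftrightarrow> x |\<in>| asm e"
proof (induction e arbitrary: k rule: expr.induct[where ?P2.0 = "\<lambda>_. True" and ?P3.0 = "\<lambda>_. True"])
  case (Sym S es)
  then show ?case by (fastforce simp: in_ffUnion_fimage fset_of_list_elem)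
next
  case (Mv M \<B> ts)
  then show ?case by (fastforce simp: in_ffUnion_fimage fset_of_list_elem)
qed (auto simp: in_ffUnion_fimage annotated_in_unbind annotated_asm_lift_atom)

lemma annotated_asm_up:
  "\<lbrakk>x |\<in>| asm (up \<sigma> n); annotated x\<rbrakk> \<Longrightarrow> \<exists>m. x |\<in>| asm (\<sigma> m)"
  by (cases n) (auto simp: up_def annotated_asm_lift)

lemma annotated_asm_subst_asm:
  assumes "x |\<in>| asm (Asm (subst_asm \<sigma> \<alpha>))" "annotated x"
  shows "x |\<in>| asm (Asm \<alpha>) \<or> (\<exists>n. x |\<in>| asm (\<sigma> n))"
proof -
  obtain z y where z: "z |\<in>| \<alpha>" "y |\<in>| subst_atom \<sigma> z" "x |\<in>| asm_atom y"
    using assms(1) by (auto simp: subst_asm_def in_ffUnion_fimage)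
  show ?thesis
    using z assms(2) by (cases z) (auto simp: in_ffUnion_fimage dest: annotated_asm_trans(1))
qed

lemma annotated_asm_subst:
  "\<lbrakk>x |\<in>| asm (subst \<sigma> e); annotated x\<rbrakk> \<Longrightarrow> x |\<in>| asm e \<or> (\<exists>n. x |\<in>| asm (\<sigma> n))"
proof (induction e arbitrary: \<sigma> rule: expr.induct[where ?P2.0 = "\<lambda>_. True" and ?P3.0 = "\<lambda>_. True"])
  case (Sym S es)
  then show ?case by (fastforce simp: in_ffUnion_fimage fset_of_list_elem)
next
  case (Mv M \<B> ts)
  then show ?case by (fastforce simp: in_ffUnion_fimage fset_of_list_elem)
next
  case (Cv t \<alpha>)
  then show ?case using annotated_asm_subst_asm[of x \<sigma> \<alpha>] by auto
next
  case (Asm \<alpha>)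
  then show ?case using annotated_asm_subst_asm[of x \<sigma> \<alpha>] by auto
next
  case (Abs e)
  then show ?case using annotated_asm_up[of x \<sigma>] by (auto simp: annotated_in_unbind)
qed auto

lemma annotated_asm_subst_jdg:
  "\<lbrakk>x |\<in>| asm_jdg (subst_jdg \<sigma> \<J>); annotated x\<rbrakk>
    \<Longrightarrow> x |\<in>| asm_jdg \<J> \<or> (\<exists>n. x |\<in>| asm (\<sigma> n))"
proof (induction \<J> arbitrary: \<sigma>)
  case (JEqTy A B \<alpha>)
  then show ?case
    using annotated_asm_subst_asm[of x \<sigma> \<alpha>] by (auto dest: annotated_asm_subst)
next
  case (JEqTm s t A \<alpha>)
  then show ?case
    using annotated_asm_subst_asm[of x \<sigma> \<alpha>] by (auto dest: annotated_asm_subst)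
next
  case (JAbs A \<J>)
  then show ?case
    using annotated_asm_up[of x \<sigma>] by (auto simp: annotated_in_unbind dest: annotated_asm_subst)
qed (auto dest: annotated_asm_subst)

section \<open>Boundaries of judgements\<close>

lemma bdry_of_subst_jdg: "bdry_of (subst_jdg \<sigma> \<J>) = subst_bdry \<sigma> (bdry_of \<J>)"
  by (induction \<J> arbitrary: \<sigma>) auto

lemma bdry_of_inst_jdg: "bdry_of (inst_jdg I \<J>) = inst_bdry I (bdry_of \<J>)"
  by (induction \<J>) auto

text \<open>A core is never an abstraction, so \<open>fill\<close> reduces whatever the head
  is.\<close>

lemma bdry_of_fill_core:
  "bdry_of (fill (subst_bdry \<sigma> (core \<B>)) e) = subst_bdry \<sigma> (core \<B>)"
  by (induction \<B>) auto

lemma unbind_mono: "\<alpha> |\<subseteq>| \<beta> \<Longrightarrow> unbind \<alpha> |\<subseteq>| unbind \<beta>"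
  unfolding unbind_def by auto

lemma asm_bdry_of: "asm_bdry (bdry_of \<J>) |\<subseteq>| asm_jdg \<J>"
  by (induction \<J>) (auto dest: unbind_mono)

lemma fv_bdry_of: "fv_bdry (bdry_of \<J>) \<subseteq> fv_jdg \<J>"
  using asm_bdry_of by (fastforce simp: fv_bdry_def fv_jdg_def)

lemma wf_bdry_of: "wf_jdg \<Sigma> k \<J> \<Longrightarrow> wf_bdry \<Sigma> k (bdry_of \<J>)"
  by (induction \<J> arbitrary: k) (auto intro: wf_expr_wf_atom_wf_bdry.intros)

lemma deriv_bdry_eqtyD:
  "deriv_bdry \<Sigma> T (BEqTy A B) \<Longrightarrow> deriv_jdg \<Sigma> T (JTy A) \<and> deriv_jdg \<Sigma> T (JTy B)"
  by (erule deriv_bdry.cases) auto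

lemma deriv_bdry_eqtmD:
  "deriv_bdry \<Sigma> T (BEqTm s t A) \<Longrightarrow>
    deriv_jdg \<Sigma> T (JTy A) \<and> deriv_jdg \<Sigma> T (JTm s A) \<and> deriv_jdg \<Sigma> T (JTm t A)"
  by (erule deriv_bdry.cases) auto

lemma deriv_bdry_tmD: "deriv_bdry \<Sigma> T (BTm A) \<Longrightarrow> deriv_jdg \<Sigma> T (JTy A)"
  by (erule deriv_bdry.cases) auto

section \<open>Well-typed annotations\<close>

lemma well_typed_annotations_mono:
  assumes "well_typed_annotations \<Sigma> T \<J>" "\<And>x. x |\<in>| asm_jdg \<J>' \<Longrightarrow> x |\<in>| asm_jdg \<J>"
  shows "well_typed_annotations \<Sigma> T \<J>'"
  using assms unfolding well_typed_annotations_def by blast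

text \<open>Suitability carries well-typed annotations from the conclusion back to a premise,
  because every assumption of the premise is recorded in the conclusion.\<close>

lemma well_typed_annotations_premise:
  assumes "well_typed_annotations \<Sigma> T \<J>" "suitable \<J>s \<J>" "\<J>' \<in> set \<J>s"
  shows "well_typed_annotations \<Sigma> T \<J>'"
proof (rule well_typed_annotations_mono[OF assms(1)])
  fix x assume "x |\<in>| asm_jdg \<J>'"
  then have "x |\<in>| asm_jdgs \<J>s"
    using assms(3) by (auto simp: asm_jdgs_def in_ffUnion_fimage fset_of_list_elem)
  then show "x |\<in>| asm_jdg \<J>"
    using assms(2) by (simp add: suitable_def)
qed

text \<open>Opening the binder can add \<open>AFv a A\<close>, which is covered by the derivability
  of \<open>A\<close>, and atoms of \<open>asm A\<close>, which occur in \<open>JAbs A \<J>\<close>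
  already.\<close>

lemma well_typed_annotations_subst_Fv:
  assumes "well_typed_annotations \<Sigma> T (JAbs A \<J>)" "deriv_jdg \<Sigma> T (JTy A)"
  shows "well_typed_annotations \<Sigma> T (subst_jdg (inst [Fv a A]) \<J>)"
proof -
  have "x |\<in>| asm_jdg (JAbs A \<J>) \<or> x = AFv a A"
    if "x |\<in>| asm_jdg (subst_jdg (inst [Fv a A]) \<J>)" "annotated x" for x
    \<comment> \<open>Index 0 is sent to \<open>Fv a A\<close>, every other index to some
      \<open>Bv\<close>, which contributes nothing annotated.\<close>
    using annotated_asm_subst_jdg[OF that] that(2)
    by (auto simp: annotated_in_unbind inst_def split: if_splits)
  then show ?thesis
    using assms unfolding well_typed_annotations_def
    by (metis annotated.simps(1,3) atom.inject(1) atom.distinct(3))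
qed

section \<open>Presuppositivity\<close>

text \<open>Phrasing the claim through \<open>bdry_of\<close> lets the induction run over arbitrary
  judgements instead of those of the form \<open>fill \<B> e\<close>.\<close>

lemma deriv_bdry_of:
  assumes "deriv_jdg \<Sigma> T \<J>" "well_typed_annotations \<Sigma> T \<J>"
  shows "deriv_bdry \<Sigma> T (bdry_of \<J>)"
  using assms
\<comment> \<open>Boundary premises are used as they stand, so boundary derivations carry the
  trivial predicate.\<close>
proof (induction rule: deriv_jdg_deriv_bdry.inducts(1)[where ?P2.0 = "\<lambda>_. True"])
  case (cf_var a A)
  then show ?case
    by (auto simp: well_typed_annotations_def intro: cf_bdry_tm)
next
  case (cf_abstr A a \<J>)
  \<comment> \<open>Since \<open>bdry_of\<close> commutes with substitution, the free variable that
    opened \<open>\<J>\<close> also serves for \<open>cf_bdry_abstr\<close>.\<close>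
  have "deriv_bdry \<Sigma> T (subst_bdry (inst [Fv a A]) (bdry_of \<J>))"
    using cf_abstr by (metis bdry_of_subst_jdg well_typed_annotations_subst_Fv)
  moreover have "(a, A) \<notin> fv_bdry (bdry_of \<J>)"
    using cf_abstr fv_bdry_of by blast
  moreover have "wf_bdry \<Sigma> 0 (BAbs A (bdry_of \<J>))"
    using cf_abstr wf_bdry_of by (metis bdry_of.simps(5))
  ultimately show ?case
    using cf_abstr cf_bdry_abstr by simp
next
  case (cf_meta ts \<B> M)
  then show ?case by (simp add: bdry_of_fill_core)
next
  case (cf_meta_congr_ty \<B> ss ts t' Ps \<alpha> M \<gamma>)
  \<comment> \<open>\<open>cf_meta\<close> applies to both sides: their argument premises are in
    \<open>Ps\<close>, and \<open>BTy\<close> is derivable outright.\<close>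
  have "deriv_jdg \<Sigma> T (JTy (Mv M \<B> us))" if "us \<in> {ss, ts}" for us
    using deriv_jdg_deriv_bdry.cf_meta[of us \<B> \<Sigma> T M] cf_meta_congr_ty that
    by (auto intro: cf_bdry_ty)
  then show ?case by (auto intro: cf_bdry_eqty)
next
  case (cf_meta_congr_tm \<B> B ss ts t' v M Ps \<alpha> \<gamma>)
  let ?B = "subst (inst ss) B"
  \<comment> \<open>The induction hypothesis for \<open>v\<close> yields the boundary premise that
    \<open>cf_meta\<close> requires at \<open>ss\<close>.\<close>
  have "well_typed_annotations \<Sigma> T (JTm v ?B)"
    using cf_meta_congr_tm.prems by (rule well_typed_annotations_mono) auto
  then have v: "deriv_jdg \<Sigma> T (JTm v ?B)" "deriv_bdry \<Sigma> T (BTm ?B)"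
    using cf_meta_congr_tm by auto
  have "deriv_jdg \<Sigma> T (JTm (Mv M \<B> ss) ?B)"
    using deriv_jdg_deriv_bdry.cf_meta[of ss \<B> \<Sigma> T M] cf_meta_congr_tm v by auto
  with v show ?case by (auto intro: cf_bdry_eqtm dest: deriv_bdry_tmD)
next
  case (cf_eqty_refl A\<^sub>1 A\<^sub>2)
  then show ?case by (auto intro: cf_bdry_eqty)
next
  case (cf_eqty_sym A B \<alpha>)
  have "well_typed_annotations \<Sigma> T (JEqTy A B \<alpha>)"
    using cf_eqty_sym.prems by (rule well_typed_annotations_mono) auto
  with cf_eqty_sym show ?case by (auto intro: cf_bdry_eqty dest: deriv_bdry_eqtyD)
next
  case (cf_eqty_trans A B \<alpha> B' C \<beta> \<gamma>)
  have "well_typed_annotations \<Sigma> T (JEqTy A B \<alpha>)" "well_typed_annotations \<Sigma> T (JEqTy B' C \<beta>)"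
    by (rule well_typed_annotations_premise[OF cf_eqty_trans.prems cf_eqty_trans.hyps(4)], simp)+
  with cf_eqty_trans show ?case by (auto intro: cf_bdry_eqty dest: deriv_bdry_eqtyD)
next
  case (cf_eqtm_refl t\<^sub>1 A t\<^sub>2)
  have "well_typed_annotations \<Sigma> T (JTm t\<^sub>1 A)"
    using cf_eqtm_refl.prems by (rule well_typed_annotations_mono) auto
  with cf_eqtm_refl show ?case by (auto intro: cf_bdry_eqtm dest: deriv_bdry_tmD)
next
  case (cf_eqtm_sym s t A \<alpha>)
  have "well_typed_annotations \<Sigma> T (JEqTm s t A \<alpha>)"
    using cf_eqtm_sym.prems by (rule well_typed_annotations_mono) auto
  with cf_eqtm_sym show ?case by (auto intro: cf_bdry_eqtm dest: deriv_bdry_eqtmD)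
next
  case (cf_eqtm_trans s t A \<alpha> t' u \<beta> \<gamma>)
  have "well_typed_annotations \<Sigma> T (JEqTm s t A \<alpha>)" "well_typed_annotations \<Sigma> T (JEqTm t' u A \<beta>)"
    by (rule well_typed_annotations_premise[OF cf_eqtm_trans.prems cf_eqtm_trans.hyps(4)], simp)+
  with cf_eqtm_trans show ?case by (auto intro: cf_bdry_eqtm dest: deriv_bdry_eqtmD)
next
  case (cf_conv_tm t A B \<alpha> \<beta>)
  \<comment> \<open>The source type \<open>A\<close> is no longer part of the conclusion; by the
    side condition the assumptions of \<open>A\<close> and \<open>\<alpha>\<close> survive in
    \<open>t\<close>, \<open>B\<close> or \<open>\<beta>\<close>.\<close>
  have "asm_jdg (JEqTy A B \<alpha>) |\<subseteq>| asm_jdg (JTm (Cv t \<beta>) B)"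
    using cf_conv_tm.hyps(3) by auto
  then have "well_typed_annotations \<Sigma> T (JEqTy A B \<alpha>)"
    using well_typed_annotations_mono[OF cf_conv_tm.prems] by blast
  with cf_conv_tm show ?case by (auto intro: cf_bdry_tm dest: deriv_bdry_eqtyD)
next
  case (cf_conv_eqtm s t A \<alpha> B \<beta> \<gamma> \<delta>)
  have "asm_jdg (JEqTm s t A \<alpha>) |\<subseteq>| asm_jdg (JEqTm (Cv s \<gamma>) (Cv t \<delta>) B \<alpha>)"
    "asm_jdg (JEqTy A B \<beta>) |\<subseteq>| asm_jdg (JEqTm (Cv s \<gamma>) (Cv t \<delta>) B \<alpha>)"
    using cf_conv_eqtm.hyps(3) by auto
  then have "well_typed_annotations \<Sigma> T (JEqTm s t A \<alpha>)" "well_typed_annotations \<Sigma> T (JEqTy A B \<beta>)"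
    using well_typed_annotations_mono[OF cf_conv_eqtm.prems] by blast+
  then have st: "deriv_jdg \<Sigma> T (JTm s A)" "deriv_jdg \<Sigma> T (JTm t A)" "deriv_jdg \<Sigma> T (JTy B)"
    using cf_conv_eqtm by (auto dest: deriv_bdry_eqtyD deriv_bdry_eqtmD)
  \<comment> \<open>Each side is converted on its own, by the side condition that belongs to
    it.\<close>
  moreover have "deriv_jdg \<Sigma> T (JTm (Cv s \<gamma>) B)" "deriv_jdg \<Sigma> T (JTm (Cv t \<delta>) B)"
    using deriv_jdg_deriv_bdry.cf_conv_tm[OF st(1)] deriv_jdg_deriv_bdry.cf_conv_tm[OF st(2)]
      cf_conv_eqtm by auto
  ultimately show ?case by (auto intro: cf_bdry_eqtm)
next
  case (cf_specific Ms \<J> I)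
  then show ?case by (simp add: bdry_of_inst_jdg)
next
  case (cf_congr_ty Ms A I J g' Ps \<alpha> \<gamma>)
  \<comment> \<open>\<open>cf_specific\<close> gives either side, its boundary premise being
    \<open>BTy\<close>.\<close>
  have "deriv_jdg \<Sigma> T (JTy (inst_expr K A))" if "K \<in> {I, J}" for K
    using deriv_jdg_deriv_bdry.cf_specific[of Ms "JTy A" T \<Sigma> K] cf_congr_ty that
    by (auto intro: cf_bdry_ty)
  then show ?case by (auto intro: cf_bdry_eqty)
next
  case (cf_congr_tm Ms t A I J g' t' Ps \<alpha> \<gamma>)
  \<comment> \<open>As for metavariables, the boundary that \<open>cf_specific\<close> requires at
    \<open>I\<close> comes from the premise on \<open>t'\<close>.\<close>
  have "well_typed_annotations \<Sigma> T (JTm t' (inst_expr I A))"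
    using cf_congr_tm.prems by (rule well_typed_annotations_mono) auto
  then have t': "deriv_jdg \<Sigma> T (JTm t' (inst_expr I A))" "deriv_bdry \<Sigma> T (BTm (inst_expr I A))"
    using cf_congr_tm by auto
  have "deriv_jdg \<Sigma> T (JTm (inst_expr I t) (inst_expr I A))"
    using deriv_jdg_deriv_bdry.cf_specific[of Ms "JTm t A" T \<Sigma> I] cf_congr_tm t' by auto
  with t' show ?case by (auto intro: cf_bdry_eqtm dest: deriv_bdry_tmD)
qed simp_all

theorem mainTheorem10:
  fixes \<Sigma> :: "'s signature" and T :: "'s rule set" and \<B> :: "'s bdry" and e :: "'s expr"
  assumes "raw_type_theory \<Sigma> T"
    and "wf_bdry \<Sigma> 0 \<B>" and "wf_expr \<Sigma> 0 (arity_of \<B>) e"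
    and "deriv_jdg \<Sigma> T (fill \<B> e)"
    and "well_typed_annotations \<Sigma> T (fill \<B> e)"
  shows "deriv_bdry \<Sigma> T \<B>"
  \<comment> \<open>The arity of \<open>e\<close> makes \<open>BAbs\<close> boundaries meet
    \<open>Abs\<close> heads, so \<open>bdry_of\<close> recovers \<open>\<B>\<close>.\<close>
  using deriv_bdry_of[OF assms(4,5)] bdry_of_fill[OF assms(3)] by simp

end
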